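(* The following conditions are equivalent for any ring $R$: (1) $R$ is $P$-symmetric. (2) $T_n(R)$, the ring of all $n\times n$ upper triangular matrices over $R$, is $P$-symmetric for any $n\geq 1$. (3) $S_n(R)$, the ring of all $n\times n$ upper triangular matrices over $R$ whose diagonal entries are all equal, is $P$-symmetric for any $n\geq 1$. (4) $V_n(R)$, the ring of all $n\times n$ upper triangular Toeplitz matrices over $R$, i.e. matrices whose $(i,j)$ entry is $a_{j-i}$ for $i\le j$ and $0$ for $i>j$, where $a_0,a_1,\dots,a_{n-1}\in R$, is $P$-symmetric for any $n\geq 1$.
   Context: Rings are associative with identity (not necessarily commutative). $P(R)$ denotes the prime radical of a ring $R$ (the intersection of all prime two-sided ideals of $R$). A ring $R$ is $P$-symmetric if for any $a,b,c\in R$, $abc=0$ implies $bac\in P(R)$. *)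

theory Defs
  imports
    "HOL-Algebra.Ideal_Product"
    "HOL-Algebra.Subrings"
    "Jordan_Normal_Form.Matrix"
begin

(* The library's primeideal presupposes a commutative ring and an elementwise condition;
   over a noncommutative ring primeness refers to products of two-sided ideals. *)
locale nc_primeideal = ideal P R for P and R (structure) +
  assumes proper: "P \<noteq> carrier R"
    and prime: "\<lbrakk>ideal I R; ideal J R; I \<cdot> J \<subseteq> P\<rbrakk> \<Longrightarrow> I \<subseteq> P \<or> J \<subseteq> P"

(* The intersection is taken inside carrier R, so the zero ring, which has no prime ideals,
   is its own prime radical. *)
definition prime_radical :: "('a, 'm) ring_scheme \<Rightarrow> 'a set" where
  "prime_radical R = {x \<in> carrier R. \<forall>P. nc_primeideal P R \<longrightarrow> x \<in> P}"

locale P_symmetric_ring = ring R for R (structure) +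
  assumes P_symmetric:
    "\<lbrakk>a \<in> carrier R; b \<in> carrier R; c \<in> carrier R; a \<otimes> b \<otimes> c = \<zero>\<rbrakk>
      \<Longrightarrow> b \<otimes> a \<otimes> c \<in> prime_radical R"

(* The type 'a mat serves only as a container here: the type-class based operations on
   it are not used, since the entries live in a ring given as a record.
   Row and column indices range from 0 to n - 1. *)
definition matrix_ring :: "('a, 'm) ring_scheme \<Rightarrow> nat \<Rightarrow> 'a mat ring" where
  "matrix_ring R n =
    \<lparr>carrier = {A \<in> carrier_mat n n. \<forall>i<n. \<forall>j<n. A $$ (i, j) \<in> carrier R},
     monoid.mult = (\<lambda>A B. mat n n (\<lambda>(i, j). \<Oplus>\<^bsub>R\<^esub>k\<in>{..<n}. A $$ (i, k) \<otimes>\<^bsub>R\<^esub> B $$ (k, j))),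
     one = mat n n (\<lambda>(i, j). if i = j then \<one>\<^bsub>R\<^esub> else \<zero>\<^bsub>R\<^esub>),
     zero = mat n n (\<lambda>(i, j). \<zero>\<^bsub>R\<^esub>),
     add = (\<lambda>A B. mat n n (\<lambda>(i, j). A $$ (i, j) \<oplus>\<^bsub>R\<^esub> B $$ (i, j)))\<rparr>"

definition T_carrier :: "('a, 'm) ring_scheme \<Rightarrow> nat \<Rightarrow> 'a mat set" where
  "T_carrier R n =
    {A \<in> carrier (matrix_ring R n). \<forall>i<n. \<forall>j<i. A $$ (i, j) = \<zero>\<^bsub>R\<^esub>}"

definition S_carrier :: "('a, 'm) ring_scheme \<Rightarrow> nat \<Rightarrow> 'a mat set" where
  "S_carrier R n = {A \<in> T_carrier R n. \<forall>i<n. \<forall>j<n. A $$ (i, i) = A $$ (j, j)}"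

definition V_carrier :: "('a, 'm) ring_scheme \<Rightarrow> nat \<Rightarrow> 'a mat set" where
  "V_carrier R n =
    {mat n n (\<lambda>(i, j). if i \<le> j then a (j - i) else \<zero>\<^bsub>R\<^esub>) | a. \<forall>k<n. a k \<in> carrier R}"

definition T_ring :: "('a, 'm) ring_scheme \<Rightarrow> nat \<Rightarrow> 'a mat ring" where
  "T_ring R n = (matrix_ring R n)\<lparr>carrier := T_carrier R n\<rparr>"

definition S_ring :: "('a, 'm) ring_scheme \<Rightarrow> nat \<Rightarrow> 'a mat ring" where
  "S_ring R n = (matrix_ring R n)\<lparr>carrier := S_carrier R n\<rparr>"

definition V_ring :: "('a, 'm) ring_scheme \<Rightarrow> nat \<Rightarrow> 'a mat ring" where
  "V_ring R n = (matrix_ring R n)\<lparr>carrier := V_carrier R n\<rparr>"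

end

theory Submission
  imports Defs "HOL-Algebra.QuotRing"
begin

text \<open>A prime ideal of a ring of triangular matrices contains the kernel of some diagonal projection,
  because the product of these kernels, taken in order, is zero. Hence it is the preimage of a prime
  ideal of \<open>R\<close>, and a triangular matrix whose diagonal entries all lie in \<open>P(R)\<close> lies in the prime
  radical of the matrix ring. Since \<open>ABC = 0\<close> forces the same relation on the diagonal entries, this
  gives (2), (3) and (4) from (1) simultaneously; each converse is the case \<open>n = 1\<close>.\<close>

section \<open>Prime ideals and surjective homomorphisms\<close>

text \<open>Surjectivity lifts an arbitrary multiplier from \<open>S\<close> to \<open>R\<close>,
  where \<open>I\<close> absorbs it.\<close>

lemma (in ring_hom_ring) ideal_image:
  assumes "ideal I R" and surj: "h ` carrier R = carrier S"
  shows "ideal (h ` I) S"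
proof (rule idealI)
  interpret I: ideal I R by fact
  show "ring S" by (rule S.ring_axioms)
  show "subgroup (h ` I) (add_monoid S)"
    by (rule group_hom.subgroup_img_is_subgroup[OF a_group_hom I.a_subgroup])
  fix a x assume a: "a \<in> h ` I" and x: "x \<in> carrier S"
  obtain i where i: "i \<in> I" "a = h i" using a by blast
  obtain r where r: "r \<in> carrier R" "x = h r" using x surj by (metis imageE)
  have "h (r \<otimes> i) \<in> h ` I" "h (i \<otimes> r) \<in> h ` I"
    by (rule imageI, simp add: i r I.I_l_closed I.I_r_closed)+
  then show "x \<otimes>\<^bsub>S\<^esub> a \<in> h ` I" "a \<otimes>\<^bsub>S\<^esub> x \<in> h ` I"
    using i r I.Icarr[OF i(1)] by simp_all
qed

text \<open>Some \<open>q\<close> in \<open>Q\<close> has the same image as \<open>x\<close>; the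
  difference lies in the kernel, hence in \<open>Q\<close>, and adding \<open>q\<close> back
  recovers \<open>x\<close>.\<close>

lemma (in ring_hom_ring) mem_of_hom_mem_image:
  assumes "ideal Q R" and ker: "a_kernel R S h \<subseteq> Q"
    and x: "x \<in> carrier R" and "h x \<in> h ` Q"
  shows "x \<in> Q"
proof -
  interpret Q: ideal Q R by fact
  obtain q where q: "q \<in> Q" "h x = h q" using assms(4) by blast
  have "h (x \<ominus> q) = \<zero>\<^bsub>S\<^esub>"
    using x q Q.Icarr[OF q(1)] by (simp add: a_minus_def S.r_neg)
  moreover have "x \<ominus> q \<in> carrier R"
    using x Q.Icarr[OF q(1)] by simp
  ultimately have "x \<ominus> q \<in> a_kernel R S h"
    unfolding a_kernel_def' by blast
  then have "x \<ominus> q \<in> Q" using ker by blast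
  then have "(x \<ominus> q) \<oplus> q \<in> Q" using q(1) by (rule Q.a_closed)
  moreover have "(x \<ominus> q) \<oplus> q = x"
    using x Q.Icarr[OF q(1)] by (simp add: a_minus_def R.a_assoc R.l_neg)
  ultimately show ?thesis by simp
qed

text \<open>Ideals of \<open>S\<close> are tested through their preimages, to which the primeness of
  \<open>Q\<close> applies; the kernel condition lets membership in \<open>Q\<close> be checked
  after applying \<open>h\<close>.\<close>

lemma (in ring_hom_ring) nc_primeideal_image:
  assumes prime: "nc_primeideal Q R" and surj: "h ` carrier R = carrier S"
    and ker: "a_kernel R S h \<subseteq> Q"
  shows "nc_primeideal (h ` Q) S"
proof -
  interpret Q: nc_primeideal Q R by fact
  note mem_Q = mem_of_hom_mem_image[OF Q.ideal_axioms ker]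
  show ?thesis
  proof (intro nc_primeideal.intro nc_primeideal_axioms.intro)
    show "ideal (h ` Q) S" by (rule ideal_image[OF Q.ideal_axioms surj])
    have "carrier R \<subseteq> Q" if "h ` Q = carrier S"
      using that mem_Q hom_closed by blast
    then show "h ` Q \<noteq> carrier S"
      using Q.proper Q.a_subset by blast
  next
    fix I J assume I: "ideal I S" and J: "ideal J S" and IJ: "I \<cdot>\<^bsub>S\<^esub> J \<subseteq> h ` Q"
    let ?I = "{r \<in> carrier R. h r \<in> I}" and ?J = "{r \<in> carrier R. h r \<in> J}"
    \<comment> \<open>The ideal product is generated inductively by products and sums, and
      \<open>h\<close> preserves both.\<close>
    have "x \<in> carrier R \<and> h x \<in> I \<cdot>\<^bsub>S\<^esub> J" if "x \<in> ?I \<cdot> ?J" for x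
      using that by (induction rule: ideal_prod.induct) (auto intro: ideal_prod.intros)
    then have "?I \<cdot> ?J \<subseteq> Q"
      using IJ mem_Q by blast
    then have "?I \<subseteq> Q \<or> ?J \<subseteq> Q"
      by (intro Q.prime ideal_vimage I J)
    moreover have "I \<subseteq> h ` ?I" "J \<subseteq> h ` ?J"
      using ideal.Icarr[OF I] ideal.Icarr[OF J] surj by (auto simp: image_iff)
    ultimately show "I \<subseteq> h ` Q \<or> J \<subseteq> h ` Q" by blast
  qed
qed

text \<open>A prime \<open>Q\<close> contains \<open>F N = 0\<close> but not \<open>F 0\<close>, so it contains some \<open>F (Suc m)\<close> and not
  \<open>F m\<close>; primeness then puts the kernel of \<open>d m\<close> inside \<open>Q\<close>, and the image of \<open>Q\<close> under
  \<open>d m\<close> is a prime ideal of \<open>R\<close>.\<close>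

lemma P_symmetric_ring_of_ideal_chain:
  fixes S (structure) and F :: "nat \<Rightarrow> _ set"
  assumes R: "P_symmetric_ring R"
    and hom: "\<And>i. i < N \<Longrightarrow> ring_hom_ring S R (d i)"
    and surj: "\<And>i. i < N \<Longrightarrow> d i ` carrier S = carrier R"
    and S: "ring S"
    and ideal: "\<And>m. m \<le> N \<Longrightarrow> ideal (F m) S"
    and F_0: "F 0 = carrier S" and F_N: "F N = {\<zero>}"
    and step: "\<And>m x y. \<lbrakk>m < N; x \<in> F m; y \<in> carrier S; d m y = \<zero>\<^bsub>R\<^esub>\<rbrakk> \<Longrightarrow> x \<otimes> y \<in> F (Suc m)"
  shows "P_symmetric_ring S"
proof (intro P_symmetric_ring.intro P_symmetric_ring_axioms.intro S)
  interpret S: ring S by fact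
  interpret R: P_symmetric_ring R by fact
  fix a b c
  assume abc: "a \<in> carrier S" "b \<in> carrier S" "c \<in> carrier S" and eq: "a \<otimes> b \<otimes> c = \<zero>"
  have "b \<otimes> a \<otimes> c \<in> Q" if "nc_primeideal Q S" for Q
  proof -
    interpret Q: nc_primeideal Q S by fact
    have "F N \<subseteq> Q" using F_N by simp
    moreover have "\<not> F 0 \<subseteq> Q" using F_0 Q.proper Q.a_subset by blast
    \<comment> \<open>The predicate is \<open>F i \<subseteq> Q\<close>; the rule returns the index
      just before its first success.\<close>
    ultimately have "\<exists>m<N. (\<forall>i\<le>m. \<not> F i \<subseteq> Q) \<and> F (Suc m) \<subseteq> Q"
      by (rule ex_least_nat_less)
    then obtain m where m: "m < N" "\<not> F m \<subseteq> Q" "F (Suc m) \<subseteq> Q" by blast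
    interpret d: ring_hom_ring S R "d m" by (rule hom[OF m(1)])
    interpret F: ideal "F (Suc m)" S using ideal m(1) by simp
    \<comment> \<open>The assumption \<open>step\<close> treats only single products; sums of them
      stay inside because \<open>F (Suc m)\<close> is an ideal.\<close>
    have "x \<in> F (Suc m)" if "x \<in> F m \<cdot> a_kernel S R (d m)" for x
      using that
    proof (induction rule: ideal_prod.induct)
      case (prod x y)
      then show ?case unfolding a_kernel_def' by (intro step[OF m(1)]) blast+
    next
      case (sum x y)
      then show ?case by (intro F.a_closed)
    qed
    then have "F m \<cdot> a_kernel S R (d m) \<subseteq> Q" using m(3) by blast
    moreover have "ideal (F m) S" using ideal m(1) by simp
    ultimately have ker: "a_kernel S R (d m) \<subseteq> Q"
      using Q.prime[OF _ d.kernel_is_ideal] m(2) by blast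
    have "d m a \<otimes>\<^bsub>R\<^esub> d m b \<otimes>\<^bsub>R\<^esub> d m c = \<zero>\<^bsub>R\<^esub>"
      using abc arg_cong[OF eq, of "d m"] by simp
    then have "d m b \<otimes>\<^bsub>R\<^esub> d m a \<otimes>\<^bsub>R\<^esub> d m c \<in> prime_radical R"
      using abc by (intro R.P_symmetric) auto
    \<comment> \<open>The image of \<open>Q\<close> is one of the prime ideals whose intersection is
      the prime radical of \<open>R\<close>.\<close>
    then have "d m (b \<otimes> a \<otimes> c) \<in> d m ` Q"
      using abc d.nc_primeideal_image[OF that surj[OF m(1)] ker] by (simp add: prime_radical_def)
    then show ?thesis
      using abc by (intro d.mem_of_hom_mem_image[OF Q.ideal_axioms ker]) auto
  qed
  then show "b \<otimes> a \<otimes> c \<in> prime_radical S"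
    using abc by (simp add: prime_radical_def)
qed

text \<open>A chain of length one suffices: \<open>h\<close> has trivial kernel, so the step
  condition reduces to \<open>x \<otimes> \<zero> = \<zero>\<close>.\<close>

lemma P_symmetric_ring_of_bij_hom:
  assumes "P_symmetric_ring R" and "ring_hom_ring S R h" and "bij_betw h (carrier S) (carrier R)"
  shows "P_symmetric_ring S"
proof -
  interpret h: ring_hom_ring S R h by fact
  have eq: "y = \<zero>\<^bsub>S\<^esub>" if "y \<in> carrier S" "h y = \<zero>\<^bsub>R\<^esub>" for y
    using that assms(3) by (metis h.hom_zero h.R.zero_closed bij_betw_def inj_onD)
  show ?thesis
    by (rule P_symmetric_ring_of_ideal_chain[where N = 1 and d = "\<lambda>_. h" and
          F = "\<lambda>m. if m = 0 then carrier S else {\<zero>\<^bsub>S\<^esub>}", OF assms(1)])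
      (use assms h.R.ring_axioms h.R.oneideal h.R.zeroideal in
        \<open>auto simp: bij_betw_def dest: eq\<close>)
qed

text \<open>To be applied with the shift matrix as \<open>z\<close>, whose centralizer consists of
  the Toeplitz matrices.\<close>

lemma (in ring) subring_centralizer:
  assumes z: "z \<in> carrier R"
  shows "subring {x \<in> carrier R. x \<otimes> z = z \<otimes> x} R"
proof (rule subringI)
  fix x y assume xy: "x \<in> {x \<in> carrier R. x \<otimes> z = z \<otimes> x}" "y \<in> {x \<in> carrier R. x \<otimes> z = z \<otimes> x}"
  have "(x \<otimes> y) \<otimes> z = x \<otimes> (z \<otimes> y)" using xy z by (simp add: m_assoc)
  also have "\<dots> = z \<otimes> (x \<otimes> y)" using xy z by (simp flip: m_assoc)
  finally show "x \<otimes> y \<in> {x \<in> carrier R. x \<otimes> z = z \<otimes> x}" using xy by simp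
qed (use z in \<open>auto simp: l_distr r_distr l_minus r_minus\<close>)

section \<open>The matrix ring\<close>

lemma matrix_ring_carrier_iff:
  "A \<in> carrier (matrix_ring R n) \<longleftrightarrow>
    A \<in> carrier_mat n n \<and> (\<forall>i<n. \<forall>j<n. A $$ (i, j) \<in> carrier R)"
  by (simp add: matrix_ring_def)

lemma matrix_ring_entry_closed:
  "\<lbrakk>A \<in> carrier (matrix_ring R n); i < n; j < n\<rbrakk> \<Longrightarrow> A $$ (i, j) \<in> carrier R"
  by (simp add: matrix_ring_carrier_iff)

lemma mat_mem_matrix_ring_iff:
  "mat n n f \<in> carrier (matrix_ring R n) \<longleftrightarrow> (\<forall>i<n. \<forall>j<n. f (i, j) \<in> carrier R)"
  by (simp add: matrix_ring_carrier_iff)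

lemma matrix_ring_eqI:
  assumes "A \<in> carrier (matrix_ring R n)" "B \<in> carrier (matrix_ring R n)"
    and "\<And>i j. \<lbrakk>i < n; j < n\<rbrakk> \<Longrightarrow> A $$ (i, j) = B $$ (i, j)"
  shows "A = B"
  using assms by (auto simp: matrix_ring_carrier_iff intro!: eq_matI)

lemma matrix_ring_index:
  assumes "i < n" "j < n"
  shows "(A \<otimes>\<^bsub>matrix_ring R n\<^esub> B) $$ (i, j) = (\<Oplus>\<^bsub>R\<^esub>k\<in>{..<n}. A $$ (i, k) \<otimes>\<^bsub>R\<^esub> B $$ (k, j))"
    and "(A \<oplus>\<^bsub>matrix_ring R n\<^esub> B) $$ (i, j) = A $$ (i, j) \<oplus>\<^bsub>R\<^esub> B $$ (i, j)"
    and "\<one>\<^bsub>matrix_ring R n\<^esub> $$ (i, j) = (if i = j then \<one>\<^bsub>R\<^esub> else \<zero>\<^bsub>R\<^esub>)"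
    and "\<zero>\<^bsub>matrix_ring R n\<^esub> $$ (i, j) = \<zero>\<^bsub>R\<^esub>"
  using assms by (simp_all add: matrix_ring_def)

context ring
begin

section \<open>Finite sums: collapse to one term and interchange\<close>

lemma finsum_lessThan_single:
  fixes n :: nat
  assumes m: "m < n" "f m \<in> carrier R" and zero: "\<And>k. \<lbrakk>k < n; k \<noteq> m\<rbrakk> \<Longrightarrow> f k = \<zero>"
  shows "(\<Oplus>k\<in>{..<n}. f k) = f m"
proof -
  have "(\<Oplus>k\<in>{..<n}. f k) = (\<Oplus>k\<in>{..<n}. if m = k then f k else \<zero>)"
    by (rule finsum_cong') (use m zero in auto)
  also have "\<dots> = f m"
    by (rule finsum_singleton) (use m zero in force)+
  finally show ?thesis .
qed

lemma finsum_lessThan_zero: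
  fixes n :: nat
  assumes "\<And>k. k < n \<Longrightarrow> f k = \<zero>"
  shows "(\<Oplus>k\<in>{..<n}. f k) = \<zero>"
proof -
  have "(\<Oplus>k\<in>{..<n}. f k) = (\<Oplus>k\<in>{..<n}. \<zero>)"
    by (rule finsum_cong') (use assms in auto)
  then show ?thesis by simp
qed

lemma finsum_swap:
  assumes "finite A" "finite B" "\<And>x y. \<lbrakk>x \<in> A; y \<in> B\<rbrakk> \<Longrightarrow> f x y \<in> carrier R"
  shows "(\<Oplus>x\<in>A. \<Oplus>y\<in>B. f x y) = (\<Oplus>y\<in>B. \<Oplus>x\<in>A. f x y)"
  using assms(1,3)
proof (induction A rule: finite_induct)
  case empty
  then show ?case by simp
next
  case (insert a A)
  have "(\<Oplus>x\<in>insert a A. \<Oplus>y\<in>B. f x y) = (\<Oplus>y\<in>B. f a y) \<oplus> (\<Oplus>y\<in>B. \<Oplus>x\<in>A. f x y)"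
    using insert by (subst finsum_insert) (auto intro!: finsum_closed)
  also have "\<dots> = (\<Oplus>y\<in>B. f a y \<oplus> (\<Oplus>x\<in>A. f x y))"
    using insert.prems by (intro finsum_addf[symmetric]) (auto intro!: finsum_closed)
  also have "\<dots> = (\<Oplus>y\<in>B. \<Oplus>x\<in>insert a A. f x y)"
    using insert by (intro finsum_cong') (auto intro!: finsum_closed)
  finally show ?case .
qed

section \<open>Ring axioms for square matrices\<close>

lemma matrix_ring_closed:
  assumes "A \<in> carrier (matrix_ring R n)" "B \<in> carrier (matrix_ring R n)"
  shows "A \<otimes>\<^bsub>matrix_ring R n\<^esub> B \<in> carrier (matrix_ring R n)"
    and "A \<oplus>\<^bsub>matrix_ring R n\<^esub> B \<in> carrier (matrix_ring R n)"
  using assms by (auto simp: matrix_ring_def intro!: finsum_closed)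

lemma matrix_ring_const_closed:
  "\<one>\<^bsub>matrix_ring R n\<^esub> \<in> carrier (matrix_ring R n)" "\<zero>\<^bsub>matrix_ring R n\<^esub> \<in> carrier (matrix_ring R n)"
  by (auto simp: matrix_ring_def)

text \<open>Both sides expand to the same double sum over the two inner indices, up to the order of
  summation.\<close>

lemma matrix_ring_assoc:
  assumes A: "A \<in> carrier (matrix_ring R n)" and B: "B \<in> carrier (matrix_ring R n)"
    and C: "C \<in> carrier (matrix_ring R n)"
  shows "(A \<otimes>\<^bsub>matrix_ring R n\<^esub> B) \<otimes>\<^bsub>matrix_ring R n\<^esub> C =
    A \<otimes>\<^bsub>matrix_ring R n\<^esub> (B \<otimes>\<^bsub>matrix_ring R n\<^esub> C)"
proof (rule matrix_ring_eqI[where R = R and n = n])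
  fix i j assume ij: "i < n" "j < n"
  note closed = matrix_ring_entry_closed[OF A] matrix_ring_entry_closed[OF B]
    matrix_ring_entry_closed[OF C]
  have "((A \<otimes>\<^bsub>matrix_ring R n\<^esub> B) \<otimes>\<^bsub>matrix_ring R n\<^esub> C) $$ (i, j) =
      (\<Oplus>k\<in>{..<n}. (\<Oplus>l\<in>{..<n}. A $$ (i, l) \<otimes> B $$ (l, k)) \<otimes> C $$ (k, j))"
    unfolding matrix_ring_index(1)[OF ij]
    by (rule finsum_cong') (use ij closed in \<open>auto simp: matrix_ring_index intro!: finsum_closed\<close>)
  also have "\<dots> = (\<Oplus>k\<in>{..<n}. \<Oplus>l\<in>{..<n}. A $$ (i, l) \<otimes> (B $$ (l, k) \<otimes> C $$ (k, j)))"
    by (intro finsum_cong')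
      (use ij closed in \<open>auto simp: finsum_ldistr m_assoc intro!: finsum_closed finsum_cong'\<close>)
  also have "\<dots> = (\<Oplus>l\<in>{..<n}. \<Oplus>k\<in>{..<n}. A $$ (i, l) \<otimes> (B $$ (l, k) \<otimes> C $$ (k, j)))"
    by (rule finsum_swap) (use ij closed in auto)
  also have "\<dots> = (\<Oplus>l\<in>{..<n}. A $$ (i, l) \<otimes> (\<Oplus>k\<in>{..<n}. B $$ (l, k) \<otimes> C $$ (k, j)))"
    by (intro finsum_cong')
      (use ij closed in \<open>auto simp: finsum_rdistr Pi_def intro!: finsum_closed\<close>)
  also have "\<dots> = (A \<otimes>\<^bsub>matrix_ring R n\<^esub> (B \<otimes>\<^bsub>matrix_ring R n\<^esub> C)) $$ (i, j)"
    unfolding matrix_ring_index(1)[OF ij]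
    by (rule finsum_cong') (use ij closed in \<open>auto simp: matrix_ring_index intro!: finsum_closed\<close>)
  finally show "((A \<otimes>\<^bsub>matrix_ring R n\<^esub> B) \<otimes>\<^bsub>matrix_ring R n\<^esub> C) $$ (i, j) =
    (A \<otimes>\<^bsub>matrix_ring R n\<^esub> (B \<otimes>\<^bsub>matrix_ring R n\<^esub> C)) $$ (i, j)" .
qed (use assms matrix_ring_closed in auto)

lemma matrix_ring_one:
  assumes A: "A \<in> carrier (matrix_ring R n)"
  shows "\<one>\<^bsub>matrix_ring R n\<^esub> \<otimes>\<^bsub>matrix_ring R n\<^esub> A = A" "A \<otimes>\<^bsub>matrix_ring R n\<^esub> \<one>\<^bsub>matrix_ring R n\<^esub> = A"
proof -
  note closed = matrix_ring_entry_closed[OF A]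
  show "\<one>\<^bsub>matrix_ring R n\<^esub> \<otimes>\<^bsub>matrix_ring R n\<^esub> A = A"
  proof (rule matrix_ring_eqI[where R = R and n = n])
    fix i j assume ij: "i < n" "j < n"
    then show "(\<one>\<^bsub>matrix_ring R n\<^esub> \<otimes>\<^bsub>matrix_ring R n\<^esub> A) $$ (i, j) = A $$ (i, j)"
      unfolding matrix_ring_index(1)[OF ij]
      by (subst finsum_lessThan_single[of i]) (use closed in \<open>auto simp: matrix_ring_index\<close>)
  qed (use A matrix_ring_closed matrix_ring_const_closed in auto)
  show "A \<otimes>\<^bsub>matrix_ring R n\<^esub> \<one>\<^bsub>matrix_ring R n\<^esub> = A"
  proof (rule matrix_ring_eqI[where R = R and n = n])
    fix i j assume ij: "i < n" "j < n"
    then show "(A \<otimes>\<^bsub>matrix_ring R n\<^esub> \<one>\<^bsub>matrix_ring R n\<^esub>) $$ (i, j) = A $$ (i, j)"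
      unfolding matrix_ring_index(1)[OF ij]
      by (subst finsum_lessThan_single[of j]) (use closed in \<open>auto simp: matrix_ring_index\<close>)
  qed (use A matrix_ring_closed matrix_ring_const_closed in auto)
qed

lemma matrix_ring_distr:
  assumes A: "A \<in> carrier (matrix_ring R n)" and B: "B \<in> carrier (matrix_ring R n)"
    and C: "C \<in> carrier (matrix_ring R n)"
  shows "(A \<oplus>\<^bsub>matrix_ring R n\<^esub> B) \<otimes>\<^bsub>matrix_ring R n\<^esub> C =
      (A \<otimes>\<^bsub>matrix_ring R n\<^esub> C) \<oplus>\<^bsub>matrix_ring R n\<^esub> (B \<otimes>\<^bsub>matrix_ring R n\<^esub> C)" (is ?l)
    and "C \<otimes>\<^bsub>matrix_ring R n\<^esub> (A \<oplus>\<^bsub>matrix_ring R n\<^esub> B) =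
      (C \<otimes>\<^bsub>matrix_ring R n\<^esub> A) \<oplus>\<^bsub>matrix_ring R n\<^esub> (C \<otimes>\<^bsub>matrix_ring R n\<^esub> B)" (is ?r)
proof -
  note closed = matrix_ring_entry_closed[OF A] matrix_ring_entry_closed[OF B]
    matrix_ring_entry_closed[OF C]
  show ?l
  proof (rule matrix_ring_eqI[where R = R and n = n])
    fix i j assume ij: "i < n" "j < n"
    then show "((A \<oplus>\<^bsub>matrix_ring R n\<^esub> B) \<otimes>\<^bsub>matrix_ring R n\<^esub> C) $$ (i, j) =
      ((A \<otimes>\<^bsub>matrix_ring R n\<^esub> C) \<oplus>\<^bsub>matrix_ring R n\<^esub> (B \<otimes>\<^bsub>matrix_ring R n\<^esub> C)) $$ (i, j)"
      unfolding matrix_ring_index(1,2)[OF ij]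
      by (subst finsum_cong'[where g = "\<lambda>k. A $$ (i, k) \<otimes> C $$ (k, j) \<oplus> B $$ (i, k) \<otimes> C $$ (k, j)"])
        (use closed in \<open>auto simp: matrix_ring_index l_distr\<close>)
  qed (use assms matrix_ring_closed in auto)
  show ?r
  proof (rule matrix_ring_eqI[where R = R and n = n])
    fix i j assume ij: "i < n" "j < n"
    then show "(C \<otimes>\<^bsub>matrix_ring R n\<^esub> (A \<oplus>\<^bsub>matrix_ring R n\<^esub> B)) $$ (i, j) =
      ((C \<otimes>\<^bsub>matrix_ring R n\<^esub> A) \<oplus>\<^bsub>matrix_ring R n\<^esub> (C \<otimes>\<^bsub>matrix_ring R n\<^esub> B)) $$ (i, j)"
      unfolding matrix_ring_index(1,2)[OF ij]
      by (subst finsum_cong'[where g = "\<lambda>k. C $$ (i, k) \<otimes> A $$ (k, j) \<oplus> C $$ (i, k) \<otimes> B $$ (k, j)"])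
        (use closed in \<open>auto simp: matrix_ring_index r_distr\<close>)
  qed (use assms matrix_ring_closed in auto)
qed

text \<open>The record fixes no negation; this supplies the inverse for the group axioms and later
  identifies the entries of \<open>\<ominus>\<close>.\<close>

lemma matrix_ring_neg:
  assumes "A \<in> carrier (matrix_ring R n)"
  shows "mat n n (\<lambda>(i, j). \<ominus> A $$ (i, j)) \<oplus>\<^bsub>matrix_ring R n\<^esub> A = \<zero>\<^bsub>matrix_ring R n\<^esub>"
  using assms by (auto simp: matrix_ring_def l_neg intro!: eq_matI)

lemma ring_matrix_ring: "ring (matrix_ring R n)"
proof (rule ringI)
  show "abelian_group (matrix_ring R n)"
  proof (rule abelian_groupI)
    fix A assume A: "A \<in> carrier (matrix_ring R n)"
    then show "\<exists>B\<in>carrier (matrix_ring R n). B \<oplus>\<^bsub>matrix_ring R n\<^esub> A = \<zero>\<^bsub>matrix_ring R n\<^esub>"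
      by (intro bexI[where x = "mat n n (\<lambda>(i, j). \<ominus> A $$ (i, j))"] matrix_ring_neg) (auto simp: matrix_ring_carrier_iff)
  qed (auto simp: matrix_ring_closed matrix_ring_const_closed matrix_ring_index
      matrix_ring_entry_closed a_ac intro!: matrix_ring_eqI[where R = R and n = n])
  show "Group.monoid (matrix_ring R n)"
    by (rule monoidI)
      (auto simp: matrix_ring_closed matrix_ring_const_closed matrix_ring_assoc matrix_ring_one)
qed (auto simp: matrix_ring_distr)

lemma matrix_ring_a_inv_index:
  assumes A: "A \<in> carrier (matrix_ring R n)" and ij: "i < n" "j < n"
  shows "(\<ominus>\<^bsub>matrix_ring R n\<^esub> A) $$ (i, j) = \<ominus> A $$ (i, j)"
proof -
  interpret M: ring "matrix_ring R n" by (rule ring_matrix_ring)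
  have "\<ominus>\<^bsub>matrix_ring R n\<^esub> A = mat n n (\<lambda>(i, j). \<ominus> A $$ (i, j))"
    using A by (intro M.minus_equality matrix_ring_neg) (auto simp: matrix_ring_carrier_iff)
  then show ?thesis using ij by simp
qed

section \<open>Triangular matrices\<close>

lemma T_carrierD:
  assumes "A \<in> T_carrier R n"
  shows "A \<in> carrier (matrix_ring R n)" "\<lbrakk>j < i; i < n\<rbrakk> \<Longrightarrow> A $$ (i, j) = \<zero>"
  using assms by (auto simp: T_carrier_def)

text \<open>In the sum for the entry, \<open>A\<close> kills the terms with \<open>k < i\<close> and
  \<open>B\<close> those with \<open>k > i\<close>. This makes the diagonal projections
  multiplicative.\<close>

lemma T_mult_diag:
  assumes A: "A \<in> T_carrier R n" and B: "B \<in> T_carrier R n" and i: "i < n"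
  shows "(A \<otimes>\<^bsub>matrix_ring R n\<^esub> B) $$ (i, i) = A $$ (i, i) \<otimes> B $$ (i, i)"
  unfolding matrix_ring_index(1)[OF i i]
proof (rule finsum_lessThan_single[OF i])
  note closed = matrix_ring_entry_closed[OF T_carrierD(1)]
  show "A $$ (i, i) \<otimes> B $$ (i, i) \<in> carrier R" using closed A B i by blast
  fix k assume "k < n" "k \<noteq> i"
  then show "A $$ (i, k) \<otimes> B $$ (k, i) = \<zero>"
    using closed[OF A] closed[OF B] T_carrierD(2)[OF A] T_carrierD(2)[OF B] i
    by (cases "k < i") auto
qed

lemma subring_T_carrier: "subring (T_carrier R n) (matrix_ring R n)"
proof -
  interpret M: ring "matrix_ring R n" by (rule ring_matrix_ring)
  show ?thesis
  proof (rule M.subringI)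
    fix A B assume A: "A \<in> T_carrier R n" and B: "B \<in> T_carrier R n"
    note closed = matrix_ring_entry_closed[OF T_carrierD(1)]
    have "(A \<otimes>\<^bsub>matrix_ring R n\<^esub> B) $$ (i, j) = \<zero>" if ij: "i < n" "j < i" for i j
    proof -
      \<comment> \<open>Either \<open>k < i\<close> and the entry of \<open>A\<close> vanishes, or
        \<open>j < i \<le> k\<close> and that of \<open>B\<close> does.\<close>
      have "A $$ (i, k) \<otimes> B $$ (k, j) = \<zero>" if "k < n" for k
        using closed[OF A] closed[OF B] T_carrierD(2)[OF A] T_carrierD(2)[OF B] that ij
        by (cases "k < i") auto
      then show ?thesis
        using ij by (simp add: matrix_ring_index finsum_lessThan_zero)
    qed
    then show "A \<otimes>\<^bsub>matrix_ring R n\<^esub> B \<in> T_carrier R n"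
      using A B by (simp add: T_carrier_def)
  qed (auto simp: T_carrier_def matrix_ring_index matrix_ring_a_inv_index)
qed

text \<open>Naming the common diagonal value makes closure under the operations immediate; for
  \<open>n = 0\<close> any value serves.\<close>

lemma S_carrier_iff:
  "A \<in> S_carrier R n \<longleftrightarrow> A \<in> T_carrier R n \<and> (\<exists>a. \<forall>i<n. A $$ (i, i) = a)"
proof
  assume "A \<in> S_carrier R n"
  then show "A \<in> T_carrier R n \<and> (\<exists>a. \<forall>i<n. A $$ (i, i) = a)"
    unfolding S_carrier_def by (cases "n = 0") blast+
next
  assume "A \<in> T_carrier R n \<and> (\<exists>a. \<forall>i<n. A $$ (i, i) = a)"
  then show "A \<in> S_carrier R n" unfolding S_carrier_def by force
qed

lemma subring_S_carrier: "subring (S_carrier R n) (matrix_ring R n)"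
proof -
  interpret M: ring "matrix_ring R n" by (rule ring_matrix_ring)
  note T = subringE[OF subring_T_carrier[of n]]
  show ?thesis
  proof (rule M.subringI)
    show "S_carrier R n \<subseteq> carrier (matrix_ring R n)" using T(1) S_carrier_iff by blast
    show "\<one>\<^bsub>matrix_ring R n\<^esub> \<in> S_carrier R n"
      using T(3) by (simp add: S_carrier_iff matrix_ring_index)
    fix A assume "A \<in> S_carrier R n"
    then obtain a where A: "A \<in> T_carrier R n" "\<forall>i<n. A $$ (i, i) = a"
      unfolding S_carrier_iff by blast
    then show "\<ominus>\<^bsub>matrix_ring R n\<^esub> A \<in> S_carrier R n"
      using T(5) by (simp add: S_carrier_iff matrix_ring_a_inv_index[OF T_carrierD(1)])
    fix B assume "B \<in> S_carrier R n"
    then obtain b where B: "B \<in> T_carrier R n" "\<forall>i<n. B $$ (i, i) = b"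
      unfolding S_carrier_iff by blast
    show "A \<otimes>\<^bsub>matrix_ring R n\<^esub> B \<in> S_carrier R n" "A \<oplus>\<^bsub>matrix_ring R n\<^esub> B \<in> S_carrier R n"
      using A B T(6,7) by (simp_all add: S_carrier_iff T_mult_diag matrix_ring_index(2))
  qed
qed

section \<open>Toeplitz matrices as the centralizer of the nilpotent Jordan block\<close>

definition shift_mat :: "nat \<Rightarrow> 'a mat" where
  "shift_mat n = mat n n (\<lambda>(i, j). if j = Suc i then \<one> else \<zero>)"

lemma shift_mat_closed: "shift_mat n \<in> carrier (matrix_ring R n)"
  by (auto simp: shift_mat_def mat_mem_matrix_ring_iff)

text \<open>Right multiplication moves the columns one place to the right and fills column 0 with
  zeros.\<close>

lemma mult_shift_mat_index:
  assumes A: "A \<in> carrier (matrix_ring R n)" and ij: "i < n" "j < n"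
  shows "(A \<otimes>\<^bsub>matrix_ring R n\<^esub> shift_mat n) $$ (i, j) = (if j = 0 then \<zero> else A $$ (i, j - 1))"
proof (cases j)
  case 0
  then show ?thesis using ij matrix_ring_entry_closed[OF A]
    by (auto simp: matrix_ring_index shift_mat_def intro!: finsum_lessThan_zero)
next
  case (Suc m)
  then show ?thesis
    unfolding matrix_ring_index(1)[OF ij]
    by (subst finsum_lessThan_single[of m])
      (use ij matrix_ring_entry_closed[OF A] in \<open>auto simp: shift_mat_def\<close>)
qed

text \<open>Left multiplication moves the rows one place up and fills the last row with
  zeros.\<close>

lemma shift_mat_mult_index:
  assumes A: "A \<in> carrier (matrix_ring R n)" and ij: "i < n" "j < n"
  shows "(shift_mat n \<otimes>\<^bsub>matrix_ring R n\<^esub> A) $$ (i, j) = (if Suc i < n then A $$ (Suc i, j) else \<zero>)"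
proof (cases "Suc i < n")
  case False
  then show ?thesis using ij matrix_ring_entry_closed[OF A]
    by (auto simp: matrix_ring_index shift_mat_def intro!: finsum_lessThan_zero)
next
  case True
  then show ?thesis
    unfolding matrix_ring_index(1)[OF ij]
    by (subst finsum_lessThan_single[of "Suc i"])
      (use ij matrix_ring_entry_closed[OF A] in \<open>auto simp: shift_mat_def\<close>)
qed

text \<open>Commuting with the shift says that entries are constant along diagonals and that column
  0 vanishes below row 0; together these force the triangular Toeplitz shape.\<close>

lemma V_carrier_eq_centralizer:
  "V_carrier R n = {A \<in> carrier (matrix_ring R n).
    A \<otimes>\<^bsub>matrix_ring R n\<^esub> shift_mat n = shift_mat n \<otimes>\<^bsub>matrix_ring R n\<^esub> A}"
proof (intro equalityI subsetI)
  fix A assume "A \<in> V_carrier R n"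
  then obtain a where A: "A = mat n n (\<lambda>(i, j). if i \<le> j then a (j - i) else \<zero>)"
    and a: "\<forall>k<n. a k \<in> carrier R"
    by (auto simp: V_carrier_def)
  then have closed: "A \<in> carrier (matrix_ring R n)"
    by (auto simp: mat_mem_matrix_ring_iff)
  have "A \<otimes>\<^bsub>matrix_ring R n\<^esub> shift_mat n = shift_mat n \<otimes>\<^bsub>matrix_ring R n\<^esub> A"
  proof (rule matrix_ring_eqI[where R = R and n = n])
    fix i j assume ij: "i < n" "j < n"
    then show "(A \<otimes>\<^bsub>matrix_ring R n\<^esub> shift_mat n) $$ (i, j) = (shift_mat n \<otimes>\<^bsub>matrix_ring R n\<^esub> A) $$ (i, j)"
      unfolding mult_shift_mat_index[OF closed ij] shift_mat_mult_index[OF closed ij]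
      by (cases j) (auto simp: A)
  qed (auto simp: closed shift_mat_closed matrix_ring_closed)
  with closed show "A \<in> {A \<in> carrier (matrix_ring R n).
    A \<otimes>\<^bsub>matrix_ring R n\<^esub> shift_mat n = shift_mat n \<otimes>\<^bsub>matrix_ring R n\<^esub> A}" by simp
next
  fix A assume "A \<in> {A \<in> carrier (matrix_ring R n).
    A \<otimes>\<^bsub>matrix_ring R n\<^esub> shift_mat n = shift_mat n \<otimes>\<^bsub>matrix_ring R n\<^esub> A}"
  then have closed: "A \<in> carrier (matrix_ring R n)"
    and comm: "A \<otimes>\<^bsub>matrix_ring R n\<^esub> shift_mat n = shift_mat n \<otimes>\<^bsub>matrix_ring R n\<^esub> A" by auto
  \<comment> \<open>Compares the entries at \<open>(i, j)\<close> of the two equal products.\<close>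
  have rec: "A $$ (Suc i, j) = (if j = 0 then \<zero> else A $$ (i, j - 1))"
    if "Suc i < n" "j < n" for i j
    using that mult_shift_mat_index[OF closed, of i j] shift_mat_mult_index[OF closed, of i j] comm
    by simp
  \<comment> \<open>Walking up the diagonal ends in row 0 when \<open>i \<le> j\<close>; otherwise
    it meets column 0 first, where the entry is zero.\<close>
  have toeplitz: "A $$ (i, j) = (if i \<le> j then A $$ (0, j - i) else \<zero>)" if "i < n" "j < n" for i j
    using that
  proof (induction i arbitrary: j)
    case (Suc i)
    then show ?case by (cases j) (auto simp: rec)
  qed simp
  show "A \<in> V_carrier R n"
    unfolding V_carrier_def
  proof (intro CollectI exI conjI)
    show "A = mat n n (\<lambda>(i, j). if i \<le> j then A $$ (0, j - i) else \<zero>)"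
      using closed toeplitz by (intro eq_matI) (auto simp: matrix_ring_carrier_iff)
    show "\<forall>k<n. A $$ (0, k) \<in> carrier R"
      using matrix_ring_entry_closed[OF closed] by auto
  qed
qed

text \<open>Closure of the Toeplitz matrices under products becomes associativity, without any
  convolution of coefficients.\<close>

lemma subring_V_carrier: "subring (V_carrier R n) (matrix_ring R n)"
  unfolding V_carrier_eq_centralizer
  by (rule ring.subring_centralizer[OF ring_matrix_ring shift_mat_closed])

section \<open>Scalar matrices and diagonal projections\<close>

definition scalar_mat :: "nat \<Rightarrow> 'a \<Rightarrow> 'a mat" where
  "scalar_mat n a = mat n n (\<lambda>(i, j). if i = j then a else \<zero>)"

text \<open>Scalar matrices make the diagonal projections surjective on each of the three rings, and
  for \<open>n = 1\<close> they identify \<open>R\<close> with the matrix ring.\<close>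

lemma scalar_mat_mem:
  assumes "a \<in> carrier R"
  shows "scalar_mat n a \<in> T_carrier R n" "scalar_mat n a \<in> S_carrier R n"
    "scalar_mat n a \<in> V_carrier R n"
proof -
  show "scalar_mat n a \<in> T_carrier R n" "scalar_mat n a \<in> S_carrier R n"
    using assms by (auto simp: scalar_mat_def S_carrier_def T_carrier_def mat_mem_matrix_ring_iff)
  \<comment> \<open>The Toeplitz form with coefficient sequence \<open>a\<close>, 0, 0, and so
    on.\<close>
  have "scalar_mat n a = mat n n (\<lambda>(i, j). if i \<le> j then (if j - i = 0 then a else \<zero>) else \<zero>)"
    by (auto simp: scalar_mat_def intro!: eq_matI)
  then show "scalar_mat n a \<in> V_carrier R n"
    unfolding V_carrier_def
    by (intro CollectI exI[of _ "\<lambda>k. if k = 0 then a else \<zero>"]) (use assms in auto)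
qed

lemma S_carrier_subset: "S_carrier R n \<subseteq> T_carrier R n"
  by (auto simp: S_carrier_def)

lemma V_carrier_subset: "V_carrier R n \<subseteq> T_carrier R n"
  by (auto simp: V_carrier_def T_carrier_def mat_mem_matrix_ring_iff)

lemma ring_hom_diag:
  assumes Y: "subring Y (matrix_ring R n)" "Y \<subseteq> T_carrier R n" and i: "i < n"
  shows "ring_hom_ring ((matrix_ring R n)\<lparr>carrier := Y\<rparr>) R (\<lambda>A. A $$ (i, i))"
proof (rule ring_hom_ringI2)
  show "ring ((matrix_ring R n)\<lparr>carrier := Y\<rparr>)"
    by (rule ring.subring_is_ring[OF ring_matrix_ring Y(1)])
  show "ring R" by (rule ring_axioms)
  show "(\<lambda>A. A $$ (i, i)) \<in> Ring.ring_hom ((matrix_ring R n)\<lparr>carrier := Y\<rparr>) R"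
    using Y(2) i T_carrierD(1)
    by (intro ring_hom_memI) (auto simp: T_mult_diag matrix_ring_index(2,3) subset_iff
      intro!: matrix_ring_entry_closed)
qed

text \<open>The ideals of matrices whose first \<open>m\<close> columns vanish form the required chain: if moreover
  \<open>B\<close> is triangular with \<open>B\<^sub>m\<^sub>m = 0\<close>, then \<open>A \<cdot> B\<close> has vanishing column \<open>m\<close> too.\<close>

lemma P_symmetric_triangular_subring:
  assumes sym: "P_symmetric_ring R"
    and Y: "subring Y (matrix_ring R n)" "Y \<subseteq> T_carrier R n"
    and scalar: "\<And>a. a \<in> carrier R \<Longrightarrow> scalar_mat n a \<in> Y"
  shows "P_symmetric_ring ((matrix_ring R n)\<lparr>carrier := Y\<rparr>)"
proof -
  interpret M: ring "matrix_ring R n" by (rule ring_matrix_ring)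
  note subE = subringE[OF Y(1)]
  define S where "S = (matrix_ring R n)\<lparr>carrier := Y\<rparr>"
  have S: "ring S" unfolding S_def by (rule M.subring_is_ring[OF Y(1)])
  have carrier_S: "carrier S = Y" by (simp add: S_def)
  have T: "A \<in> T_carrier R n" if "A \<in> Y" for A using that Y(2) by blast
  note closed = matrix_ring_entry_closed[OF T_carrierD(1)[OF T]]
  define F where "F m = {A \<in> Y. \<forall>i<n. \<forall>j<m. A $$ (i, j) = \<zero>}" for m
  \<comment> \<open>Only \<open>k \<le> j\<close> has to be checked, since the triangular
    \<open>B\<close> vanishes at \<open>(k, j)\<close> for \<open>k > j\<close>.\<close>
  have mult_zero: "(A \<otimes>\<^bsub>matrix_ring R n\<^esub> B) $$ (i, j) = \<zero>"
    if "A \<in> Y" "B \<in> Y" "i < n" "j < n" "\<And>k. k \<le> j \<Longrightarrow> A $$ (i, k) = \<zero> \<or> B $$ (k, j) = \<zero>"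
    for A B i j
    unfolding matrix_ring_index(1)[OF that(3,4)]
  proof (rule finsum_lessThan_zero)
    fix k assume k: "k < n"
    have "A $$ (i, k) = \<zero> \<or> B $$ (k, j) = \<zero>"
      using that(5)[of k] T_carrierD(2)[OF T[OF that(2)], of j k] k by linarith
    then show "A $$ (i, k) \<otimes> B $$ (k, j) = \<zero>"
      using closed[OF that(1,3) k] closed[OF that(2) k that(4)] by auto
  qed
  have ideal: "ideal (F m) S" if m: "m \<le> n" for m
  proof (rule idealI[OF S])
    show "subgroup (F m) (add_monoid S)"
    proof (rule group.subgroupI)
      show "Group.group (add_monoid S)"
        using abelian_group.a_group ring.is_abelian_group[OF S] by blast
      show "F m \<subseteq> carrier (add_monoid S)" by (auto simp: F_def carrier_S)
      have "\<zero>\<^bsub>matrix_ring R n\<^esub> \<in> F m"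
        using m subE(2) by (auto simp: F_def matrix_ring_index)
      then show "F m \<noteq> {}" by blast
      fix A assume A: "A \<in> F m"
      then have AY: "A \<in> Y" by (simp add: F_def)
      \<comment> \<open>Negation depends on the carrier of the record, so the two are matched by
        uniqueness of inverses in \<open>S\<close>.\<close>
      have "\<ominus>\<^bsub>S\<^esub> A = \<ominus>\<^bsub>matrix_ring R n\<^esub> A"
        using AY subE(1,5) M.l_neg
        by (intro abelian_group.minus_equality[OF ring.is_abelian_group[OF S]])
          (auto simp: S_def)
      then have "inv\<^bsub>add_monoid S\<^esub> A = \<ominus>\<^bsub>matrix_ring R n\<^esub> A"
        by (simp add: a_inv_def)
      then show "inv\<^bsub>add_monoid S\<^esub> A \<in> F m"
        using A m subE(5) AY T_carrierD(1)[OF T[OF AY]]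
        by (auto simp: F_def matrix_ring_a_inv_index)
      fix B assume B: "B \<in> F m"
      then show "A \<otimes>\<^bsub>add_monoid S\<^esub> B \<in> F m"
        using A m subE(7) by (auto simp: F_def S_def matrix_ring_index)
    qed
  next
    fix A B assume A: "A \<in> F m" and B: "B \<in> carrier S"
    have AY: "A \<in> Y" and BY: "B \<in> Y" using A B by (auto simp: F_def carrier_S)
    \<comment> \<open>In the first product column \<open>j\<close> of \<open>A\<close> is zero; in
      the second, \<open>k \<le> j < m\<close> makes every relevant entry of \<open>A\<close>
      zero.\<close>
    have "(B \<otimes>\<^bsub>matrix_ring R n\<^esub> A) $$ (i, j) = \<zero>" "(A \<otimes>\<^bsub>matrix_ring R n\<^esub> B) $$ (i, j) = \<zero>"
      if "i < n" "j < m" for i j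
      using that m A AY BY by (auto simp: F_def intro!: mult_zero)
    then show "B \<otimes>\<^bsub>S\<^esub> A \<in> F m" "A \<otimes>\<^bsub>S\<^esub> B \<in> F m"
      using AY BY subE(6) by (auto simp: F_def S_def)
  qed
  have "P_symmetric_ring S"
  proof (rule P_symmetric_ring_of_ideal_chain[where N = n and F = F, OF sym _ _ S ideal])
    fix i assume i: "i < n"
    show hom: "ring_hom_ring S R (\<lambda>A. A $$ (i, i))"
      unfolding S_def by (rule ring_hom_diag[OF Y i])
    have "a \<in> (\<lambda>A. A $$ (i, i)) ` carrier S" if "a \<in> carrier R" for a
      using scalar[OF that] i by (intro image_eqI[of _ _ "scalar_mat n a"])
        (auto simp: carrier_S scalar_mat_def)
    then show "(\<lambda>A. A $$ (i, i)) ` carrier S = carrier R"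
      using closed i by (auto simp: carrier_S)
  next
    show "F 0 = carrier S" by (simp add: F_def carrier_S)
    have "A = \<zero>\<^bsub>matrix_ring R n\<^esub>" if "A \<in> F n" for A
      using that T_carrierD(1)[OF T]
      by (intro matrix_ring_eqI[where R = R and n = n]) (auto simp: F_def matrix_ring_index)
    moreover have "\<zero>\<^bsub>matrix_ring R n\<^esub> \<in> F n"
      using subE(2) by (auto simp: F_def matrix_ring_index)
    ultimately have "F n = {\<zero>\<^bsub>matrix_ring R n\<^esub>}" by blast
    then show "F n = {\<zero>\<^bsub>S\<^esub>}" by (simp add: S_def)
  next
    fix m A B assume m: "m < n" and A: "A \<in> F m" and B: "B \<in> carrier S" "B $$ (m, m) = \<zero>"
    have AY: "A \<in> Y" and BY: "B \<in> Y" using A B by (auto simp: F_def carrier_S)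
    have "(A \<otimes>\<^bsub>matrix_ring R n\<^esub> B) $$ (i, j) = \<zero>" if "i < n" "j < Suc m" for i j
    proof (rule mult_zero[OF AY BY \<open>i < n\<close>])
      fix k assume "k \<le> j"
      \<comment> \<open>The first case falls to the zero columns of \<open>A\<close>; the second
        leaves only the diagonal entry of \<open>B\<close> at \<open>m\<close>, which is
        zero.\<close>
      then have "k < m \<or> k = m \<and> j = m" using \<open>j < Suc m\<close> by linarith
      then show "A $$ (i, k) = \<zero> \<or> B $$ (k, j) = \<zero>"
        using \<open>i < n\<close> A B(2) by (auto simp: F_def)
    qed (use \<open>j < Suc m\<close> m in simp)
    then show "A \<otimes>\<^bsub>S\<^esub> B \<in> F (Suc m)"
      using AY BY subE(6) by (auto simp: F_def S_def)
  qed
  then show ?thesis by (simp add: S_def)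
qed

text \<open>A 1 by 1 matrix is its only entry, so \<open>scalar_mat 1\<close> is an isomorphism. It
  starts at \<open>R\<close> because P-symmetry is pulled back from the target to the
  source.\<close>

lemma P_symmetric_of_1x1:
  assumes sym: "P_symmetric_ring ((matrix_ring R 1)\<lparr>carrier := Y\<rparr>)"
    and Y: "Y \<subseteq> carrier (matrix_ring R 1)"
    and scalar: "\<And>a. a \<in> carrier R \<Longrightarrow> scalar_mat 1 a \<in> Y"
  shows "P_symmetric_ring R"
proof (rule P_symmetric_ring_of_bij_hom[OF sym])
  show "ring_hom_ring R ((matrix_ring R 1)\<lparr>carrier := Y\<rparr>) (scalar_mat 1)"
  proof (rule ring_hom_ringI2[OF ring_axioms])
    show "ring ((matrix_ring R 1)\<lparr>carrier := Y\<rparr>)"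
      using sym by (rule P_symmetric_ring.axioms(1))
    show "scalar_mat 1 \<in> Ring.ring_hom R ((matrix_ring R 1)\<lparr>carrier := Y\<rparr>)"
    proof (rule ring_hom_memI)
      fix x y assume x: "x \<in> carrier R" and y: "y \<in> carrier R"
      show "scalar_mat 1 x \<in> carrier ((matrix_ring R 1)\<lparr>carrier := Y\<rparr>)"
        using scalar[OF x] by simp
      show "scalar_mat 1 (x \<otimes> y) =
          scalar_mat 1 x \<otimes>\<^bsub>(matrix_ring R 1)\<lparr>carrier := Y\<rparr>\<^esub> scalar_mat 1 y"
        using T_mult_diag[OF scalar_mat_mem(1)[OF x] scalar_mat_mem(1)[OF y], of 0 1] x y
        by (intro matrix_ring_eqI[where R = R and n = 1])
          (simp_all add: scalar_mat_def mat_mem_matrix_ring_iff matrix_ring_closed)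
      show "scalar_mat 1 (x \<oplus> y) =
          scalar_mat 1 x \<oplus>\<^bsub>(matrix_ring R 1)\<lparr>carrier := Y\<rparr>\<^esub> scalar_mat 1 y"
        by (auto simp: scalar_mat_def matrix_ring_def intro!: eq_matI)
    qed (auto simp: scalar_mat_def matrix_ring_def)
  qed
  show "bij_betw (scalar_mat 1) (carrier R) (carrier ((matrix_ring R 1)\<lparr>carrier := Y\<rparr>))"
    using Y scalar
    by (intro bij_betwI[where g = "\<lambda>A. A $$ (0, 0)"])
      (auto simp: scalar_mat_def matrix_ring_carrier_iff subset_iff intro!: eq_matI)
qed

text \<open>Stated for a family \<open>Y\<close> so that all three kinds of matrix ring are
  instances.\<close>

lemma P_symmetric_iff_triangular:
  assumes Y: "\<And>n. subring (Y n) (matrix_ring R n)" "\<And>n. Y n \<subseteq> T_carrier R n"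
    and scalar: "\<And>n a. a \<in> carrier R \<Longrightarrow> scalar_mat n a \<in> Y n"
  shows "P_symmetric_ring R \<longleftrightarrow> (\<forall>n\<ge>1. P_symmetric_ring ((matrix_ring R n)\<lparr>carrier := Y n\<rparr>))"
proof
  assume "P_symmetric_ring R"
  then show "\<forall>n\<ge>1. P_symmetric_ring ((matrix_ring R n)\<lparr>carrier := Y n\<rparr>)"
    using P_symmetric_triangular_subring Y scalar by blast
next
  assume "\<forall>n\<ge>1. P_symmetric_ring ((matrix_ring R n)\<lparr>carrier := Y n\<rparr>)"
  then have "P_symmetric_ring ((matrix_ring R 1)\<lparr>carrier := Y 1\<rparr>)" by blast
  moreover have "Y 1 \<subseteq> carrier (matrix_ring R 1)" using Y(2) T_carrierD(1) by blast
  ultimately show "P_symmetric_ring R"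
    using scalar by (rule P_symmetric_of_1x1)
qed

end

theorem theorem2p19:
  fixes R :: "('a, 'm) ring_scheme"
  assumes "ring R"
  shows "(P_symmetric_ring R \<longleftrightarrow> (\<forall>n\<ge>1. P_symmetric_ring (T_ring R n)))
    \<and> (P_symmetric_ring R \<longleftrightarrow> (\<forall>n\<ge>1. P_symmetric_ring (S_ring R n)))
    \<and> (P_symmetric_ring R \<longleftrightarrow> (\<forall>n\<ge>1. P_symmetric_ring (V_ring R n)))"
proof -
  interpret ring R by fact
  show ?thesis
    unfolding T_ring_def S_ring_def V_ring_def
    \<comment> \<open>\<open>Y\<close> becomes \<open>T_carrier R\<close>,
      \<open>S_carrier R\<close> and \<open>V_carrier R\<close> in turn; \<open>order_refl\<close>
      settles the inclusion for the first.\<close>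
    by (intro conjI P_symmetric_iff_triangular subring_T_carrier subring_S_carrier
        subring_V_carrier order_refl S_carrier_subset V_carrier_subset scalar_mat_mem)
qed

end
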